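(* Let $n=8$ and let $\boldsymbol v^0$ be the octuple-periodic field of the context at the symmetric phases $\boldsymbol\xi=(-\tfrac{\pi}{4},\tfrac{\pi}{4},\dots,\tfrac{\pi}{4})$, with $\boldsymbol g^0=(\boldsymbol v^0\cdot\nabla)\boldsymbol v^0$. With $s_k=\sin(2\alpha x_k)$ let $$p^*(\boldsymbol x)=\frac{\rho v_r^2}{64}\sum_{\substack{1\le i<j\le8\\ j-i\ \mathrm{even}}}s_is_j,$$ and define the body-force amplitude $$f_i^0(\boldsymbol x)=\frac1\rho\frac{\partial p^*}{\partial x_i}+g_i^0(\boldsymbol x)=\frac{\alpha v_r^2}{32}\cos(2\alpha x_i)\,H_i^m,\qquad i=1,\dots,8,$$ where $H_i^m$ is the polynomial given in the context (the second equality being part of the assertion). Then the velocity $\boldsymbol v(\boldsymbol x,t)=\boldsymbol v^0(\boldsymbol x)e^{-8\alpha^2\kappa t}$ together with the pressure $p(\boldsymbol x,t)=p^*(\boldsymbol x)e^{-16\alpha^2\kappa t}$ is an exact solution of the incompressible Navier--Stokes equations on $\mathbb R^8$, $t\ge0$, under the body force $\boldsymbol f(\boldsymbol x,t)=\boldsymbol f^0(\boldsymbol x)e^{-16\alpha^2\kappa t}$.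
   Context: Fix $\alpha>0$, $v_r>0$, density $\rho>0$, viscosity $\kappa>0$. The first component of the field is $$\frac{v_1^0}{v_r}=\sin(\alpha x_1+\xi_1)\cos(\alpha x_2+\xi_2)\sin(\alpha x_3+\xi_3)\cos(\alpha x_4+\xi_4)\sin(\alpha x_5+\xi_5)\cos(\alpha x_6+\xi_6)\sin(\alpha x_7+\xi_7)\cos(\alpha x_8+\xi_8)$$ $$-\sin(\alpha x_1+\xi_2)\sin(\alpha x_2+\xi_3)\cos(\alpha x_3+\xi_4)\sin(\alpha x_4+\xi_5)\cos(\alpha x_5+\xi_6)\sin(\alpha x_6+\xi_7)\cos(\alpha x_7+\xi_8)\cos(\alpha x_8+\xi_1),$$ and $v_i^0$ is obtained from $v_1^0$ by the cyclic coordinate permutation $x_j\mapsto x_{i+j-1}$ (indices modulo 8, in $\{1,\dots,8\}$) with the same $\boldsymbol\xi$. The polynomial $H_1^m$ is $H_1^m=\widetilde H_1+(s_3+s_5+s_7)$, where $$\widetilde H_1=-s_7-s_2s_4s_6-s_2s_4s_8-s_2s_6s_8-s_4s_6s_8+s_2s_4s_6s_7s_8+s_5\big[-1+s_4s_7+s_6s_7+s_7s_8+s_2(s_7+s_4s_6s_8)\big]$$ $$+s_3\big[-1+s_5s_6-2s_5s_7+s_6s_7+s_5s_8+s_7s_8-s_5s_6s_7s_8+s_4\big(s_7-s_5(-1+s_6s_7+s_7s_8)\big)+s_2\big(s_7+s_4s_6s_8-s_5(-1+s_4s_7+s_6s_7+s_7s_8)\big)\big],$$ and $H_i^m$ is obtained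 from $H_1^m$ by the index shift $s_j\mapsto s_{i+j-1}$ (indices modulo 8). The incompressible Navier--Stokes equations are $\partial_tv_i+\sum_jv_j\partial_jv_i=\kappa\Delta v_i-\rho^{-1}\partial_ip+f_i$ for all $i$, and $\nabla\cdot\boldsymbol v=0$. *)

theory Defs
  imports "HOL-Analysis.Analysis"
begin

section \<open>Partial derivatives and the incompressible Navier--Stokes equations\<close>

definition partial :: "'n::finite \<Rightarrow> (real^'n \<Rightarrow> real) \<Rightarrow> real^'n \<Rightarrow> real" where
  "partial j f x = deriv (\<lambda>h. f (x + h *\<^sub>R axis j 1)) 0"

definition has_partial :: "'n::finite \<Rightarrow> (real^'n \<Rightarrow> real) \<Rightarrow> real^'n \<Rightarrow> bool" where
  "has_partial j f x \<longleftrightarrow> (\<lambda>h. f (x + h *\<^sub>R axis j 1)) differentiable (at 0)"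

definition laplacian :: "(real^'n::finite \<Rightarrow> real) \<Rightarrow> real^'n \<Rightarrow> real" where
  "laplacian f x = (\<Sum>j\<in>UNIV. partial j (partial j f) x)"

definition divergence :: "(real^'n::finite \<Rightarrow> real^'n) \<Rightarrow> real^'n \<Rightarrow> real" where
  "divergence v x = (\<Sum>j\<in>UNIV. partial j (\<lambda>y. v y $ j) x)"

definition advection :: "(real^'n::finite \<Rightarrow> real^'n) \<Rightarrow> real^'n \<Rightarrow> real^'n" where
  "advection v x = (\<chi> i. \<Sum>j\<in>UNIV. v x $ j * partial j (\<lambda>y. v y $ i) x)"

text \<open>The time interval is \<open>{0..}\<close>, so the time derivative at \<open>t = 0\<close> is one-sided.\<close>

definition time_deriv :: "(real \<Rightarrow> real) \<Rightarrow> real \<Rightarrow> real" where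
  "time_deriv u t = vector_derivative u (at t within {0..})"

text \<open>
  The derivative operators above are total functions with unspecified values where the derivative
  does not exist, hence a classical solution must also satisfy a regularity requirement:
  all derivatives occurring in the equations (and the mixed second ones) exist and are
  continuous in \<open>(t, x)\<close>.
\<close>

definition velocity_regular :: "(real \<Rightarrow> real^'n::finite \<Rightarrow> real^'n) \<Rightarrow> bool" where
  "velocity_regular v \<longleftrightarrow>
     continuous_on ({0..} \<times> UNIV) (\<lambda>(t, x). v t x) \<and>
     (\<forall>i. (\<forall>t\<ge>0. \<forall>x. (\<lambda>s. v s x $ i) differentiable (at t within {0..})) \<and>
          continuous_on ({0..} \<times> UNIV) (\<lambda>(t, x). time_deriv (\<lambda>s. v s x $ i) t)) \<and>
     (\<forall>i j. (\<forall>t\<ge>0. \<forall>x. has_partial j (\<lambda>y. v t y $ i) x) \<and>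
          continuous_on ({0..} \<times> UNIV) (\<lambda>(t, x). partial j (\<lambda>y. v t y $ i) x)) \<and>
     (\<forall>i j k. (\<forall>t\<ge>0. \<forall>x. has_partial k (partial j (\<lambda>y. v t y $ i)) x) \<and>
          continuous_on ({0..} \<times> UNIV) (\<lambda>(t, x). partial k (partial j (\<lambda>y. v t y $ i)) x))"

definition pressure_regular :: "(real \<Rightarrow> real^'n::finite \<Rightarrow> real) \<Rightarrow> bool" where
  "pressure_regular p \<longleftrightarrow>
     continuous_on ({0..} \<times> UNIV) (\<lambda>(t, x). p t x) \<and>
     (\<forall>j. (\<forall>t\<ge>0. \<forall>x. has_partial j (p t) x) \<and>
          continuous_on ({0..} \<times> UNIV) (\<lambda>(t, x). partial j (p t) x))"

definition navier_stokes_solution ::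
  "real \<Rightarrow> real \<Rightarrow> (real \<Rightarrow> real^'n::finite \<Rightarrow> real^'n) \<Rightarrow> (real \<Rightarrow> real^'n \<Rightarrow> real)
     \<Rightarrow> (real \<Rightarrow> real^'n \<Rightarrow> real^'n) \<Rightarrow> bool" where
  "navier_stokes_solution \<rho> \<kappa> v p f \<longleftrightarrow>
     velocity_regular v \<and> pressure_regular p \<and>
     (\<forall>t\<ge>0. \<forall>x.
        (\<forall>i. time_deriv (\<lambda>s. v s x $ i) t + advection (v t) x $ i =
             \<kappa> * laplacian (\<lambda>y. v t y $ i) x - 1 / \<rho> * partial i (p t) x + f t x $ i) \<and>
        divergence (v t) x = 0)"


section \<open>The octuple-periodic field\<close>

text \<open>
  The index type \<open>8\<close> is the ring of integers modulo 8: its elements are \<open>1, \<dots>, 8\<close> with \<open>8 = 0\<close>,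
  and index arithmetic such as \<open>i + j - 1\<close> is automatically modulo 8.
\<close>

definition cyc :: "8 \<Rightarrow> real^8 \<Rightarrow> real^8" where
  "cyc i x = (\<chi> j. x $ (i + j - 1))"

definition octuple_first :: "real \<Rightarrow> real \<Rightarrow> real^8 \<Rightarrow> real^8 \<Rightarrow> real" where
  "octuple_first \<alpha> vr \<xi> x = vr *
     ( sin (\<alpha> * x$1 + \<xi>$1) * cos (\<alpha> * x$2 + \<xi>$2) * sin (\<alpha> * x$3 + \<xi>$3) * cos (\<alpha> * x$4 + \<xi>$4)
     * sin (\<alpha> * x$5 + \<xi>$5) * cos (\<alpha> * x$6 + \<xi>$6) * sin (\<alpha> * x$7 + \<xi>$7) * cos (\<alpha> * x$8 + \<xi>$8)
     - sin (\<alpha> * x$1 + \<xi>$2) * sin (\<alpha> * x$2 + \<xi>$3) * cos (\<alpha> * x$3 + \<xi>$4) * sin (\<alpha> * x$4 + \<xi>$5)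
     * cos (\<alpha> * x$5 + \<xi>$6) * sin (\<alpha> * x$6 + \<xi>$7) * cos (\<alpha> * x$7 + \<xi>$8) * cos (\<alpha> * x$8 + \<xi>$1))"

text \<open>The permutation acts on the coordinates only; the phases stay in place.\<close>

definition octuple_field :: "real \<Rightarrow> real \<Rightarrow> real^8 \<Rightarrow> real^8 \<Rightarrow> real^8" where
  "octuple_field \<alpha> vr \<xi> x = (\<chi> i. octuple_first \<alpha> vr \<xi> (cyc i x))"

definition symmetric_phases :: "real^8" where
  "symmetric_phases = (\<chi> k. if k = 1 then - pi / 4 else pi / 4)"

definition sin2 :: "real \<Rightarrow> real^8 \<Rightarrow> real^8" where
  "sin2 \<alpha> x = (\<chi> k. sin (2 * \<alpha> * x $ k))"

definition H1_tilde :: "real^8 \<Rightarrow> real" where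
  "H1_tilde s =
     - s$7 - s$2 * s$4 * s$6 - s$2 * s$4 * s$8 - s$2 * s$6 * s$8 - s$4 * s$6 * s$8
     + s$2 * s$4 * s$6 * s$7 * s$8
     + s$5 * (- 1 + s$4 * s$7 + s$6 * s$7 + s$7 * s$8 + s$2 * (s$7 + s$4 * s$6 * s$8))
     + s$3 * (- 1 + s$5 * s$6 - 2 * s$5 * s$7 + s$6 * s$7 + s$5 * s$8 + s$7 * s$8
              - s$5 * s$6 * s$7 * s$8
              + s$4 * (s$7 - s$5 * (- 1 + s$6 * s$7 + s$7 * s$8))
              + s$2 * (s$7 + s$4 * s$6 * s$8
                       - s$5 * (- 1 + s$4 * s$7 + s$6 * s$7 + s$7 * s$8)))"

definition H1_m :: "real^8 \<Rightarrow> real" where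
  "H1_m s = H1_tilde s + (s$3 + s$5 + s$7)"

definition H_m :: "8 \<Rightarrow> real^8 \<Rightarrow> real" where
  "H_m i s = H1_m (cyc i s)"

text \<open>The summation indices are natural numbers, since the order \<open>i < j\<close> matters for the sum.\<close>

definition p_star :: "real \<Rightarrow> real \<Rightarrow> real \<Rightarrow> real^8 \<Rightarrow> real" where
  "p_star \<alpha> vr \<rho> x = \<rho> * vr^2 / 64 *
     (\<Sum>(i, j) \<in> {(i::nat, j::nat). 1 \<le> i \<and> i < j \<and> j \<le> 8 \<and> even (j - i)}.
        sin2 \<alpha> x $ of_nat i * sin2 \<alpha> x $ of_nat j)"

definition v_zero :: "real \<Rightarrow> real \<Rightarrow> real^8 \<Rightarrow> real^8" where
  "v_zero \<alpha> vr = octuple_field \<alpha> vr symmetric_phases"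

definition f_zero :: "real \<Rightarrow> real \<Rightarrow> real \<Rightarrow> real^8 \<Rightarrow> real^8" where
  "f_zero \<alpha> vr \<rho> x =
     (\<chi> i. 1 / \<rho> * partial i (p_star \<alpha> vr \<rho>) x + advection (v_zero \<alpha> vr) x $ i)"

end

theory Submission
  imports Defs
begin

text \<open>
  Put \<open>a\<^sub>k = sin (\<alpha> x\<^sub>k + \<pi>/4)\<close> and \<open>b\<^sub>k = cos (\<alpha> x\<^sub>k + \<pi>/4)\<close>. At the symmetric phases the first
  velocity component is \<open>- v\<^sub>r\<close> times the sum of the two monomials
  \<open>b\<^sub>1 b\<^sub>2 a\<^sub>3 b\<^sub>4 a\<^sub>5 b\<^sub>6 a\<^sub>7 b\<^sub>8\<close> and \<open>a\<^sub>1 a\<^sub>2 b\<^sub>3 a\<^sub>4 b\<^sub>5 a\<^sub>6 b\<^sub>7 a\<^sub>8\<close>, which are exchanged by swapping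
  \<open>a\<close> and \<open>b\<close>. Each is a product of eight sines of single coordinates. A partial derivative of such
  a \<^emph>\<open>wave\<close> only advances one phase by \<open>\<pi>/2\<close> (up to the factor \<open>\<alpha>\<close>), so every wave is smooth and an
  eigenfunction of the Laplacian for \<open>- 8 \<alpha>\<^sup>2\<close>. Hence the factor \<open>exp (- 8 \<alpha>\<^sup>2 \<kappa> t)\<close> balances
  the time derivative against the viscous term. Advection is quadratic in the velocity and so
  decays like the square of that factor, as do pressure and force; the rest of the momentum equation
  is then the definition of the force amplitude.

  Everything commutes with the cyclic relabelling of the coordinates, so all componentwise
  computations reduce to the first component at a relabelled point (\<open>partial_cyc\<close>,
  \<open>v_zero_component\<close>, \<open>p_star_cyc\<close>). In particular \<open>\<partial>\<^sub>1 v\<^sub>1\<close> is a difference of one wave taken at two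
  consecutive relabellings, and the divergence telescopes around the cycle (\<open>divergence_v_zero\<close>).

  The substance is the closed form of the advection term (\<open>advection_v_zero\<close>). It rests on a polynomial
  identity modulo \<open>a\<^sub>k\<^sup>2 + b\<^sub>k\<^sup>2 = 1\<close> (\<open>advection_identity\<close>). Expanding \<open>\<Sum>\<^sub>m v\<^sub>m \<partial>\<^sub>m v\<^sub>1\<close> gives 32 monomials.
  Half of them contain \<open>a\<^sub>k b\<^sub>k\<close> for all \<open>k \<ge> 2\<close>; they cancel, because each \<open>m\<close> contributes one pair of
  them, with the common factor \<open>b\<^sub>1\<^sup>2 - a\<^sub>1\<^sup>2\<close> and a sign alternating in \<open>m\<close>. The other half all contain
  \<open>a\<^sub>1 b\<^sub>1 = cos (2 \<alpha> x\<^sub>1) / 2\<close> and otherwise only the squares \<open>a\<^sub>k\<^sup>2 = (1 + s\<^sub>k) / 2\<close> and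
  \<open>b\<^sub>k\<^sup>2 = (1 - s\<^sub>k) / 2\<close>. These are products over the even indices times products over the odd
  indices in which at most one factor is exchanged, hence they sum to an expression in the elementary
  symmetric functions \<open>e\<^sub>i\<close> of \<open>s\<^sub>2, s\<^sub>4, s\<^sub>6, s\<^sub>8\<close> and \<open>o\<^sub>i\<close> of \<open>s\<^sub>3, s\<^sub>5, s\<^sub>7\<close>. The polynomial
  \<open>H1_tilde\<close> is nothing but \<open>- e\<^sub>3 + o\<^sub>1 (e\<^sub>4 - 1) - o\<^sub>3 (2 + e\<^sub>2) + e\<^sub>1 o\<^sub>2\<close> (\<open>H1_tilde_symmetric\<close>). The
  pressure gradient contributes the extra \<open>s\<^sub>3 + s\<^sub>5 + s\<^sub>7\<close>, which turns it into \<open>H1_m\<close>.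
\<close>

section \<open>Cyclic relabelling of eight coordinates\<close>

lemma UNIV_8: "(UNIV :: 8 set) = {1, 2, 3, 4, 5, 6, 7, 8}"
  by (rule card_subset_eq [symmetric]) simp_all

lemma prod_8: "prod f (UNIV :: 8 set) = f 1 * f 2 * f 3 * f 4 * f 5 * f 6 * f 7 * f 8"
  for f :: "8 \<Rightarrow> real"
  unfolding UNIV_8 by (simp add: ac_simps)

lemma sum_8: "sum f (UNIV :: 8 set) = f 1 + f 2 + f 3 + f 4 + f 5 + f 6 + f 7 + f 8"
  for f :: "8 \<Rightarrow> real"
  unfolding UNIV_8 by (simp add: ac_simps)

text \<open>
  Rewriting indices to the representatives \<open>1, \<dots>, 8\<close> lets the simplifier identify equal coordinates.
\<close>

lemma numeral_wrap_8: "(9::8) = 1" "(10::8) = 2" "(11::8) = 3" "(12::8) = 4"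
  "(13::8) = 5" "(14::8) = 6" "(15::8) = 7"
  by simp_all

lemma sum_cyclic: "(\<Sum>m\<in>UNIV. f (i + m - 1)) = (\<Sum>j\<in>UNIV. f j)" for f :: "8 \<Rightarrow> real"
  by (rule sum.reindex_bij_witness [of _ "\<lambda>j. j - i + 1" "\<lambda>m. i + m - 1"]) auto

lemma cyc_cyc: "cyc m (cyc i x) = cyc (i + m - 1) x"
  by (simp add: cyc_def vec_eq_iff algebra_simps)

lemma sin2_cyc: "sin2 \<alpha> (cyc i x) = cyc i (sin2 \<alpha> x)"
  by (simp add: sin2_def cyc_def vec_eq_iff)

lemma cyc_line: "cyc i (x + h *\<^sub>R axis (i + m - 1) 1) = cyc i x + h *\<^sub>R axis m 1"
  by (simp add: cyc_def vec_eq_iff axis_def)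

text \<open>
  The \<open>i\<close>-th component of the field is the first one at the relabelled point, so this trades its
  derivatives for those of the first component.
\<close>

lemma partial_cyc: "partial (i + m - 1) (\<lambda>y. F (cyc i y)) x = partial m F (cyc i x)"
  by (simp add: partial_def cyc_line)

lemma has_partial_cyc:
  "has_partial (i + m - 1) (\<lambda>y. F (cyc i y)) x \<longleftrightarrow> has_partial m F (cyc i x)"
  by (simp add: has_partial_def cyc_line)

section \<open>Partial derivatives along coordinate lines\<close>

lemma partial_eqI:
  assumes "((\<lambda>h. f (x + h *\<^sub>R axis j 1)) has_real_derivative D) (at 0)"
  shows "partial j f x = D" and "has_partial j f x"
  using assms unfolding partial_def has_partial_def
  by (auto intro: DERIV_imp_deriv differentiableI has_field_derivative_imp_has_derivative)

lemma partial_cmult: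
  assumes "has_partial j f x"
  shows "partial j (\<lambda>y. c * f y) x = c * partial j f x" and "has_partial j (\<lambda>y. c * f y) x"
proof -
  have "((\<lambda>h. f (x + h *\<^sub>R axis j 1)) has_real_derivative partial j f x) (at 0)"
    using assms unfolding partial_def has_partial_def
    by (metis DERIV_deriv_iff_real_differentiable)
  from DERIV_cmult [OF this, of c] show
    "partial j (\<lambda>y. c * f y) x = c * partial j f x" "has_partial j (\<lambda>y. c * f y) x"
    by (auto intro: partial_eqI)
qed

section \<open>Products of sines in single coordinates\<close>

text \<open>
  Cosine factors are included through phases shifted by \<open>\<pi>/2\<close>; having only sines turns differentiation
  into a change of phase.
\<close>

definition wave :: "real \<Rightarrow> real^'n::finite \<Rightarrow> real^'n \<Rightarrow> real" where
  "wave \<alpha> \<phi> x = (\<Prod>k\<in>UNIV. sin (\<alpha> * x $ k + \<phi> $ k))"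

text \<open>
  A quarter turn of one phase differentiates the only factor that depends on that coordinate.
\<close>

lemma wave_has_derivative_axis:
  "((\<lambda>h. wave \<alpha> \<phi> (x + h *\<^sub>R axis j 1)) has_real_derivative
     \<alpha> * wave \<alpha> (\<phi> + axis j (pi / 2)) x) (at 0)"
proof -
  define R where "R = (\<Prod>k\<in>UNIV - {j}. sin (\<alpha> * x $ k + \<phi> $ k))"
  have line: "wave \<alpha> \<phi> (x + h *\<^sub>R axis j 1) = sin (\<alpha> * (x $ j + h) + \<phi> $ j) * R" for h
    by (simp add: wave_def R_def prod.remove [of _ j] axis_def)
  have "wave \<alpha> (\<phi> + axis j (pi / 2)) x = sin (\<alpha> * x $ j + \<phi> $ j + pi / 2) * R"
    by (simp add: wave_def R_def prod.remove [of _ j] axis_def add.assoc)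
  then have shifted: "wave \<alpha> (\<phi> + axis j (pi / 2)) x = cos (\<alpha> * x $ j + \<phi> $ j) * R"
    by (simp add: sin_add)
  show ?thesis
    unfolding line shifted by (auto intro!: derivative_eq_intros)
qed

lemma wave_half_turn:
  "wave \<alpha> (\<phi> + axis j (pi / 2) + axis j (pi / 2)) x = - wave \<alpha> \<phi> x"
proof -
  have "wave \<alpha> (\<phi> + axis j (pi / 2) + axis j (pi / 2)) x
      = sin (\<alpha> * x $ j + \<phi> $ j + pi) * (\<Prod>k\<in>UNIV - {j}. sin (\<alpha> * x $ k + \<phi> $ k))"
    by (simp add: wave_def prod.remove [of _ j] axis_def add.assoc)
  then show ?thesis
    by (simp add: wave_def prod.remove [of _ j])
qed

text \<open>
  The velocity components are sums of two waves with a common amplitude. Partial derivatives do not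
  leave this class, which makes first and second derivatives available in one form.
\<close>

definition wave_pair :: "real \<Rightarrow> real \<Rightarrow> real^'n::finite \<Rightarrow> real^'n \<Rightarrow> real^'n \<Rightarrow> real" where
  "wave_pair c \<alpha> \<phi> \<psi> x = c * (wave \<alpha> \<phi> x + wave \<alpha> \<psi> x)"

lemma partial_wave_pair:
  "partial j (wave_pair c \<alpha> \<phi> \<psi>)
     = wave_pair (c * \<alpha>) \<alpha> (\<phi> + axis j (pi / 2)) (\<psi> + axis j (pi / 2))"
  and has_partial_wave_pair: "has_partial j (wave_pair c \<alpha> \<phi> \<psi>) x"
proof -
  have "((\<lambda>h. wave_pair c \<alpha> \<phi> \<psi> (x + h *\<^sub>R axis j 1)) has_real_derivative
      wave_pair (c * \<alpha>) \<alpha> (\<phi> + axis j (pi / 2)) (\<psi> + axis j (pi / 2)) x) (at 0)" for x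
    unfolding wave_pair_def
    by (rule derivative_eq_intros wave_has_derivative_axis refl)+ (simp add: algebra_simps)
  from partial_eqI [OF this] show
    "partial j (wave_pair c \<alpha> \<phi> \<psi>)
       = wave_pair (c * \<alpha>) \<alpha> (\<phi> + axis j (pi / 2)) (\<psi> + axis j (pi / 2))"
    "has_partial j (wave_pair c \<alpha> \<phi> \<psi>) x"
    by auto
qed

text \<open>
  Two quarter turns of one phase reverse the sign, so every second partial derivative is
  \<open>- \<alpha>\<^sup>2\<close> times the function itself.
\<close>

lemma laplacian_wave_pair:
  "laplacian (wave_pair c \<alpha> \<phi> \<psi>) x
     = - real CARD('n) * \<alpha>^2 * wave_pair c \<alpha> \<phi> \<psi> (x :: real^'n::finite)"
proof -
  have "partial j (partial j (wave_pair c \<alpha> \<phi> \<psi>)) x = - (\<alpha>^2) * wave_pair c \<alpha> \<phi> \<psi> x" for j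
    unfolding partial_wave_pair wave_pair_def wave_half_turn
    by (simp add: power2_eq_square algebra_simps)
  then show ?thesis
    by (simp add: laplacian_def)
qed

section \<open>Exponentially decaying fields\<close>

lemma continuous_on_time_factor_wave_pair:
  fixes e :: "real \<Rightarrow> real" and \<phi> \<psi> :: "real^'n::finite"
  assumes "continuous_on T e"
  shows "continuous_on (T \<times> UNIV) (\<lambda>(t, x). e t * wave_pair c \<alpha> \<phi> \<psi> x)"
proof -
  have "continuous_on (T \<times> UNIV) (\<lambda>z. e (fst z))"
    by (rule continuous_on_compose2 [OF assms]) (auto intro: continuous_intros)
  moreover have "continuous_on (T \<times> UNIV) (\<lambda>z. (snd z :: real^'n) $ k)" for k
    by (intro bounded_linear.continuous_on [OF bounded_linear_vec_nth] continuous_on_snd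
      continuous_on_id)
  ultimately show ?thesis
    unfolding wave_pair_def wave_def case_prod_beta by (intro continuous_intros)
qed

text \<open>
  At \<open>t = 0\<close> the time derivative is one-sided, but \<open>0\<close> is a limit point of \<open>{0..}\<close>, so a two-sided
  derivative still determines it.
\<close>

lemma time_deriv_eqI:
  assumes "(u has_real_derivative D) (at t)" "t \<ge> 0"
  shows "time_deriv u t = D" and "u differentiable (at t within {0..})"
proof -
  have D: "(u has_vector_derivative D) (at t within {0..})"
    using assms(1) has_field_derivative_at_within has_real_derivative_iff_has_vector_derivative
    by blast
  have "t islimpt {0..}"
    using islimpt_subset [of t "{t..t+1}" "{0..}"] assms(2) by (auto simp: islimpt_Icc)
  then show "time_deriv u t = D"
    unfolding time_deriv_def using D
    by (intro vector_derivative_within) (auto simp: trivial_limit_within)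
  show "u differentiable (at t within {0..})"
    using D by (auto simp: has_vector_derivative_def intro: differentiableI)
qed

lemma velocity_regular_wave_pairs:
  assumes V: "\<And>x i. V x $ i = wave_pair c \<alpha> (\<phi> i) (\<psi> i) x"
  shows "velocity_regular (\<lambda>t x. exp (b * t) *\<^sub>R V x)"
proof -
  have comp: "(exp (b * t) *\<^sub>R V x) $ i = wave_pair (exp (b * t) * c) \<alpha> (\<phi> i) (\<psi> i) x" for t x i
    by (simp add: V wave_pair_def)
  have scale: "wave_pair (exp (b * t) * c * d) \<alpha> \<phi>' \<psi>' x = exp (b * t) * wave_pair (c * d) \<alpha> \<phi>' \<psi>' x"
    for t d x and \<phi>' \<psi>' :: "real^'a"
    by (simp add: wave_pair_def)
  have cont: "continuous_on ({0..} \<times> UNIV) (\<lambda>(t, x). e t * wave_pair d \<alpha> \<phi>' \<psi>' x)"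
    if "continuous_on {0..} e" for e :: "real \<Rightarrow> real" and d and \<phi>' \<psi>' :: "real^'a"
    using that by (rule continuous_on_time_factor_wave_pair)
  have expc: "continuous_on {0..} (\<lambda>t. exp (b * t))"
    by (intro continuous_intros)
  have td: "time_deriv (\<lambda>s. (exp (b * s) *\<^sub>R V x) $ i) t = (b * exp (b * t)) * V x $ i"
    "(\<lambda>s. (exp (b * s) *\<^sub>R V x) $ i) differentiable (at t within {0..})" if "t \<ge> 0" for t x i
    by (rule time_deriv_eqI [OF _ that]; force intro!: derivative_eq_intros)+
  have "continuous_on ({0..} \<times> UNIV) (\<lambda>(t, x). exp (b * t) *\<^sub>R V x)"
  proof (subst continuous_on_componentwise, intro ballI)
    fix u :: "real^'a" assume "u \<in> Basis"
    then obtain i where "u = axis i 1"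
      by (auto simp: Basis_vec_def)
    then show "continuous_on ({0..} \<times> UNIV) (\<lambda>z. (case z of (t, x) \<Rightarrow> exp (b * t) *\<^sub>R V x) \<bullet> u)"
      using cont [OF expc, of c "\<phi> i" "\<psi> i"] by (simp add: case_prod_beta inner_axis V)
  qed
  moreover have "continuous_on ({0..} \<times> UNIV)
      (\<lambda>(t, x). time_deriv (\<lambda>s. (exp (b * s) *\<^sub>R V x) $ i) t)" for i
  proof -
    have "continuous_on {0..} (\<lambda>t. b * exp (b * t))"
      by (intro continuous_intros)
    from cont [OF this, of c "\<phi> i" "\<psi> i"] show ?thesis
      by (rule continuous_on_eq) (auto simp: td(1) V simp del: vector_scaleR_component)
  qed
  moreover have "continuous_on ({0..} \<times> UNIV) (\<lambda>(t, x). partial j (\<lambda>y. (exp (b * t) *\<^sub>R V y) $ i) x)"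
    for i j
    unfolding comp partial_wave_pair scale
    using cont [OF expc] by blast
  moreover have "continuous_on ({0..} \<times> UNIV)
      (\<lambda>(t, x). partial k (partial j (\<lambda>y. (exp (b * t) *\<^sub>R V y) $ i)) x)" for i j k
    unfolding comp partial_wave_pair mult.assoc scale [unfolded mult.assoc]
    using cont [OF expc] by blast
  moreover have "has_partial j (\<lambda>y. (exp (b * t) *\<^sub>R V y) $ i) x" for i j t x
    unfolding comp by (rule has_partial_wave_pair)
  moreover have "has_partial k (partial j (\<lambda>y. (exp (b * t) *\<^sub>R V y) $ i)) x" for i j k t x
    unfolding comp partial_wave_pair by (rule has_partial_wave_pair)
  ultimately show ?thesis
    unfolding velocity_regular_def using td(2) by blast
qed

section \<open>The polynomial identity for the advection term\<close>

definition even_prod :: "(8 \<Rightarrow> real) \<Rightarrow> real" where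
  "even_prod x = x 2 * x 4 * x 6 * x 8"

definition odd_prod :: "(8 \<Rightarrow> real) \<Rightarrow> real" where
  "odd_prod x = x 3 * x 5 * x 7"

text \<open>
  The polynomial is symmetric in the even-indexed and, separately, in the odd-indexed variables: with
  their elementary symmetric functions \<open>e\<^sub>i\<close> and \<open>o\<^sub>i\<close> the four summands are \<open>- e\<^sub>3\<close>, \<open>o\<^sub>1 (e\<^sub>4 - 1)\<close>,
  \<open>- o\<^sub>3 (2 + e\<^sub>2)\<close> and \<open>e\<^sub>1 o\<^sub>2\<close>. The advection sum comes out in the same seven quantities.
\<close>

lemma H1_tilde_symmetric:
  "H1_tilde s = - (s$2 * s$4 * s$6 + s$2 * s$4 * s$8 + s$2 * s$6 * s$8 + s$4 * s$6 * s$8)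
     + (s$3 + s$5 + s$7) * (s$2 * s$4 * s$6 * s$8 - 1)
     - s$3 * s$5 * s$7 * (2 + (s$2 * s$4 + s$2 * s$6 + s$2 * s$8 + s$4 * s$6 + s$4 * s$8 + s$6 * s$8))
     + (s$2 + s$4 + s$6 + s$8) * (s$3 * s$5 + s$3 * s$7 + s$5 * s$7)"
  unfolding H1_tilde_def by algebra

text \<open>
  Exchanging the factor \<open>1 + p\<^sub>j\<close> for \<open>1 - p\<^sub>j\<close> reverses the sign of the monomials that contain
  \<open>p\<^sub>j\<close>. Over the unexchanged product and its four exchanges, a monomial of degree \<open>d\<close> therefore
  has total coefficient \<open>5 - 2 d\<close>.
\<close>

lemma even_prod_flips:
  fixes p :: "8 \<Rightarrow> real"
  assumes x: "\<And>k. x k = (1 + p k) / 2" and y: "\<And>k. y k = (1 - p k) / 2"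
  defines "e1 \<equiv> p 2 + p 4 + p 6 + p 8"
    and "e2 \<equiv> p 2 * p 4 + p 2 * p 6 + p 2 * p 8 + p 4 * p 6 + p 4 * p 8 + p 6 * p 8"
    and "e3 \<equiv> p 2 * p 4 * p 6 + p 2 * p 4 * p 8 + p 2 * p 6 * p 8 + p 4 * p 6 * p 8"
    and "e4 \<equiv> p 2 * p 4 * p 6 * p 8"
  shows "even_prod x = (1 + e1 + e2 + e3 + e4) / 16"
    and "even_prod x + even_prod (x(2 := y 2)) + even_prod (x(4 := y 4)) + even_prod (x(6 := y 6))
      + even_prod (x(8 := y 8)) = (5 + 3 * e1 + e2 - e3 - 3 * e4) / 16"
  unfolding e1_def e2_def e3_def e4_def
  by (simp_all add: even_prod_def x y field_simps)

text \<open>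
  Here only the three exchanged products are summed, so degree \<open>d\<close> has total coefficient \<open>3 - 2 d\<close>.
\<close>

lemma odd_prod_flips:
  fixes p :: "8 \<Rightarrow> real"
  assumes x: "\<And>k. x k = (1 + p k) / 2" and y: "\<And>k. y k = (1 - p k) / 2"
  defines "o1 \<equiv> p 3 + p 5 + p 7"
    and "o2 \<equiv> p 3 * p 5 + p 3 * p 7 + p 5 * p 7"
    and "o3 \<equiv> p 3 * p 5 * p 7"
  shows "odd_prod x = (1 + o1 + o2 + o3) / 8"
    and "odd_prod (x(3 := y 3)) + odd_prod (x(5 := y 5)) + odd_prod (x(7 := y 7))
      = (3 + o1 - o2 - 3 * o3) / 8"
  unfolding o1_def o2_def o3_def
  by (simp_all add: odd_prod_def x y field_simps)

text \<open>
  The shape of the advection sum: \<open>u\<close>, \<open>w\<close> stand for the even and \<open>v\<close>, \<open>z\<close> for the odd products, an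
  index marks the exchanged factor, and \<open>d\<close> is the part that cancels by alternation.
\<close>

lemma collect_terms:
  fixes g d u u2 u4 u6 u8 w w2 w4 w6 w8 v v3 v5 v7 z z3 z5 z7 :: real
  shows "(g * (u * z - w * v) + d) + (g * (u2 * z - w2 * v) - d) + (g * (w * v3 - u * z3) + d)
      + (g * (u4 * z - w4 * v) - d) + (g * (w * v5 - u * z5) + d) + (g * (u6 * z - w6 * v) - d)
      + (g * (w * v7 - u * z7) + d) + (g * (u8 * z - w8 * v) - d)
    = g * ((u + u2 + u4 + u6 + u8) * z - u * (z3 + z5 + z7)
           - (w + w2 + w4 + w6 + w8) * v + w * (v3 + v5 + v7))"
  by (simp add: algebra_simps)

text \<open>
  The left-hand side is \<open>\<Sum>\<^sub>m v\<^sub>m \<partial>\<^sub>m v\<^sub>1\<close> up to a constant, \<open>m\<close> being the direction of differentiation: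
  replacing the \<open>m\<close>-th factor by its derivative turns \<open>a\<close> into \<open>b\<close> and \<open>b\<close> into \<open>- a\<close>. For every \<open>m\<close> two
  of the four monomials in a summand make up the alternating term \<open>c\<close>, and the other two contain
  \<open>a\<^sub>1 b\<^sub>1\<close> and squares only.
\<close>

lemma advection_identity:
  fixes a b :: "8 \<Rightarrow> real"
  assumes one: "\<And>k. (a k)^2 + (b k)^2 = 1" and s: "\<And>k. s $ k = (a k)^2 - (b k)^2"
  shows "(\<Sum>m\<in>UNIV.
      (b m * b (m+1) * a (m+2) * b (m+3) * a (m+4) * b (m+5) * a (m+6) * b (m+7)
       + a m * a (m+1) * b (m+2) * a (m+3) * b (m+4) * a (m+5) * b (m+6) * a (m+7)) *
      ((\<Prod>k\<in>UNIV. if k = m then (if k \<in> -{3,5,7} then - a k else b k)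
                   else (if k \<in> -{3,5,7} then b k else a k))
       + (\<Prod>k\<in>UNIV. if k = m then (if k \<in> {3,5,7} then - a k else b k)
                     else (if k \<in> {3,5,7} then b k else a k))))
    = a 1 * b 1 / 16 * H1_tilde s"
    (is "(\<Sum>m\<in>UNIV. ?t m) = _")
proof -
  define A B where "A = (\<lambda>k. (a k)^2)" and "B = (\<lambda>k. (b k)^2)"
  define c where "c = ((b 1)^2 - (a 1)^2) * (a 2 * b 2 * (a 3 * b 3) * (a 4 * b 4) * (a 5 * b 5)
    * (a 6 * b 6) * (a 7 * b 7) * (a 8 * b 8))"
  note expand = prod_8 numeral_wrap_8 even_prod_def odd_prod_def A_def B_def c_def
  have term1: "?t 1 = a 1 * b 1 *
      (even_prod A * odd_prod B - even_prod B * odd_prod A) + c"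
    by (simp add: expand) algebra
  have term2: "?t 2 = a 1 * b 1 *
      (even_prod (A(2 := B 2)) * odd_prod B - even_prod (B(2 := A 2)) * odd_prod A) - c"
    by (simp add: expand) algebra
  have term3: "?t 3 = a 1 * b 1 *
      (even_prod B * odd_prod (A(3 := B 3)) - even_prod A * odd_prod (B(3 := A 3))) + c"
    by (simp add: expand) algebra
  have term4: "?t 4 = a 1 * b 1 *
      (even_prod (A(4 := B 4)) * odd_prod B - even_prod (B(4 := A 4)) * odd_prod A) - c"
    by (simp add: expand) algebra
  have term5: "?t 5 = a 1 * b 1 *
      (even_prod B * odd_prod (A(5 := B 5)) - even_prod A * odd_prod (B(5 := A 5))) + c"
    by (simp add: expand) algebra
  have term6: "?t 6 = a 1 * b 1 *
      (even_prod (A(6 := B 6)) * odd_prod B - even_prod (B(6 := A 6)) * odd_prod A) - c"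
    by (simp add: expand) algebra
  have term7: "?t 7 = a 1 * b 1 *
      (even_prod B * odd_prod (A(7 := B 7)) - even_prod A * odd_prod (B(7 := A 7))) + c"
    by (simp add: expand) algebra
  have term8: "?t 8 = a 1 * b 1 *
      (even_prod (A(8 := B 8)) * odd_prod B - even_prod (B(8 := A 8)) * odd_prod A) - c"
    by (simp add: expand) algebra
  \<comment> \<open>Both forms of each equation, since the summation formulas are needed for \<open>s\<close> and for \<open>- s\<close>.\<close>
  have A: "A k = (1 + s $ k) / 2" "A k = (1 - - s $ k) / 2"
    and B: "B k = (1 - s $ k) / 2" "B k = (1 + - s $ k) / 2" for k
    using one [of k] s [of k] by (auto simp: A_def B_def)
  define e1 where "e1 = s$2 + s$4 + s$6 + s$8"
  define e2 where "e2 = s$2 * s$4 + s$2 * s$6 + s$2 * s$8 + s$4 * s$6 + s$4 * s$8 + s$6 * s$8"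
  define e3 where "e3 = s$2 * s$4 * s$6 + s$2 * s$4 * s$8 + s$2 * s$6 * s$8 + s$4 * s$6 * s$8"
  define e4 where "e4 = s$2 * s$4 * s$6 * s$8"
  define o1 where "o1 = s$3 + s$5 + s$7"
  define o2 where "o2 = s$3 * s$5 + s$3 * s$7 + s$5 * s$7"
  define o3 where "o3 = s$3 * s$5 * s$7"
  note elementary = e1_def e2_def e3_def e4_def o1_def o2_def o3_def
  have even_A: "even_prod A = (1 + e1 + e2 + e3 + e4) / 16"
    "even_prod A + even_prod (A(2 := B 2)) + even_prod (A(4 := B 4)) + even_prod (A(6 := B 6))
      + even_prod (A(8 := B 8)) = (5 + 3 * e1 + e2 - e3 - 3 * e4) / 16"
    using even_prod_flips [where p = "\<lambda>k. s $ k", OF A(1) B(1)] by (simp_all add: elementary)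
  have even_B: "even_prod B = (1 - e1 + e2 - e3 + e4) / 16"
    "even_prod B + even_prod (B(2 := A 2)) + even_prod (B(4 := A 4)) + even_prod (B(6 := A 6))
      + even_prod (B(8 := A 8)) = (5 - 3 * e1 + e2 + e3 - 3 * e4) / 16"
    using even_prod_flips [where p = "\<lambda>k. - s $ k", OF B(2) A(2)]
    by (simp_all add: elementary algebra_simps)
  have odd_A: "odd_prod A = (1 + o1 + o2 + o3) / 8"
    "odd_prod (A(3 := B 3)) + odd_prod (A(5 := B 5)) + odd_prod (A(7 := B 7))
      = (3 + o1 - o2 - 3 * o3) / 8"
    using odd_prod_flips [where p = "\<lambda>k. s $ k", OF A(1) B(1)] by (simp_all add: elementary)
  have odd_B: "odd_prod B = (1 - o1 + o2 - o3) / 8"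
    "odd_prod (B(3 := A 3)) + odd_prod (B(5 := A 5)) + odd_prod (B(7 := A 7))
      = (3 - o1 - o2 + 3 * o3) / 8"
    using odd_prod_flips [where p = "\<lambda>k. - s $ k", OF B(2) A(2)]
    by (simp_all add: elementary algebra_simps)
  have H: "H1_tilde s = - e3 + o1 * (e4 - 1) - o3 * (2 + e2) + e1 * o2"
    by (simp add: H1_tilde_symmetric elementary)
  show ?thesis
    unfolding H sum_8 term1 term2 term3 term4 term5 term6 term7 term8 collect_terms
    unfolding even_A(2) even_B(2) odd_A(2) odd_B(2)
    unfolding even_A(1) even_B(1) odd_A(1) odd_B(1)
    by (simp add: field_simps)
qed

section \<open>The velocity field\<close>

text \<open>
  Phases for which a wave is a product of \<open>b\<^sub>k\<close> over \<open>B\<close> and of \<open>a\<^sub>k\<close> over the complement of \<open>B\<close>.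
\<close>

definition quarter_phases :: "'n::finite set \<Rightarrow> real^'n" where
  "quarter_phases B = (\<chi> k. pi / 4 + (if k \<in> B then pi / 2 else 0))"

lemma wave_quarter_phases:
  "wave \<alpha> (quarter_phases B) x
     = (\<Prod>k\<in>UNIV. if k \<in> B then cos (\<alpha> * x $ k + pi / 4) else sin (\<alpha> * x $ k + pi / 4))"
  and wave_quarter_phases_shifted:
  "wave \<alpha> (quarter_phases B + axis j (pi / 2)) x
     = (\<Prod>k\<in>UNIV. if k = j
           then (if k \<in> B then - sin (\<alpha> * x $ k + pi / 4) else cos (\<alpha> * x $ k + pi / 4))
           else (if k \<in> B then cos (\<alpha> * x $ k + pi / 4) else sin (\<alpha> * x $ k + pi / 4)))"
proof -
  have q: "sin (t + (u + pi / 2)) = cos (t + u)" for t u :: real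
    using sin_add [of "t + u" "pi / 2"] by (simp add: add.assoc)
  have h: "cos (t + (u + pi / 2)) = - sin (t + u)" for t u :: real
    using cos_add [of "t + u" "pi / 2"] by (simp add: add.assoc)
  show "wave \<alpha> (quarter_phases B) x
     = (\<Prod>k\<in>UNIV. if k \<in> B then cos (\<alpha> * x $ k + pi / 4) else sin (\<alpha> * x $ k + pi / 4))"
    unfolding wave_def quarter_phases_def
    by (rule prod.cong) (simp_all only: vec_lambda_beta q if_True if_False add_0_right split: if_split, simp)
  show "wave \<alpha> (quarter_phases B + axis j (pi / 2)) x
     = (\<Prod>k\<in>UNIV. if k = j
           then (if k \<in> B then - sin (\<alpha> * x $ k + pi / 4) else cos (\<alpha> * x $ k + pi / 4))
           else (if k \<in> B then cos (\<alpha> * x $ k + pi / 4) else sin (\<alpha> * x $ k + pi / 4)))"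
    unfolding wave_def quarter_phases_def axis_def
  proof (rule prod.cong [OF refl], goal_cases)
    case (1 k)
    show ?case
      by (cases "k = j"; cases "k \<in> B";
          simp only: vec_lambda_beta vector_add_component q h add_0_right simp_thms if_True if_False)
  qed
qed

abbreviation first_phases :: "real^8" where "first_phases \<equiv> quarter_phases (-{3, 5, 7})"
abbreviation second_phases :: "real^8" where "second_phases \<equiv> quarter_phases {3, 5, 7}"

text \<open>
  The only phase \<open>- \<pi>/4\<close> lies a quarter turn before the others: it turns the sine into \<open>- b\<^sub>1\<close> in the
  first product and the last cosine into \<open>a\<^sub>8\<close> in the second, which gives both products the sign \<open>-\<close>.
\<close>

lemma octuple_first_explicit:
  "octuple_first \<alpha> vr symmetric_phases x = - vr *
     (cos (\<alpha> * x$1 + pi/4) * cos (\<alpha> * x$2 + pi/4) * sin (\<alpha> * x$3 + pi/4) * cos (\<alpha> * x$4 + pi/4)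
      * sin (\<alpha> * x$5 + pi/4) * cos (\<alpha> * x$6 + pi/4) * sin (\<alpha> * x$7 + pi/4) * cos (\<alpha> * x$8 + pi/4)
      + sin (\<alpha> * x$1 + pi/4) * sin (\<alpha> * x$2 + pi/4) * cos (\<alpha> * x$3 + pi/4) * sin (\<alpha> * x$4 + pi/4)
      * cos (\<alpha> * x$5 + pi/4) * sin (\<alpha> * x$6 + pi/4) * cos (\<alpha> * x$7 + pi/4) * sin (\<alpha> * x$8 + pi/4))"
proof -
  have sm: "sin (t + - pi / 4) = - cos (t + pi / 4)" and cm: "cos (t + - pi / 4) = sin (t + pi / 4)" for t :: real
    by (simp_all add: sin_add cos_add sin_45 cos_45 sin_diff cos_diff)
  have \<xi>: "symmetric_phases $ k = pi / 4" if "k \<noteq> 1" for k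
    using that by (simp add: symmetric_phases_def)
  have \<xi>1: "symmetric_phases $ 1 = - pi / 4"
    by (simp add: symmetric_phases_def)
  show ?thesis
    unfolding octuple_first_def \<xi>1 by (simp add: \<xi> sm [simplified] cm [simplified] algebra_simps)
qed

lemma octuple_first_wave_pair:
  "octuple_first \<alpha> vr symmetric_phases = wave_pair (- vr) \<alpha> first_phases second_phases"
  by (rule ext) (simp add: octuple_first_explicit wave_pair_def wave_quarter_phases prod_8)

lemma octuple_first_cyc:
  "octuple_first \<alpha> vr symmetric_phases (cyc m x) = - vr *
     (let a = (\<lambda>k. sin (\<alpha> * x $ k + pi/4)); b = (\<lambda>k. cos (\<alpha> * x $ k + pi/4)) in
       b m * b (m+1) * a (m+2) * b (m+3) * a (m+4) * b (m+5) * a (m+6) * b (m+7)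
       + a m * a (m+1) * b (m+2) * a (m+3) * b (m+4) * a (m+5) * b (m+6) * a (m+7))"
proof -
  have shift: "m + 1 - 1 = m" "m + 2 - 1 = m + 1" "m + 3 - 1 = m + 2" "m + 4 - 1 = m + 3"
    "m + 5 - 1 = m + 4" "m + 6 - 1 = m + 5" "m + 7 - 1 = m + 6" "m + 8 - 1 = m + 7"
    by (simp_all add: add_diff_eq [symmetric] del: bit0_iszero_numeral)
  show ?thesis
    by (simp only: octuple_first_explicit cyc_def vec_lambda_beta shift Let_def)
qed

lemma v_zero_component: "v_zero \<alpha> vr x $ i = octuple_first \<alpha> vr symmetric_phases (cyc i x)"
  by (simp add: v_zero_def octuple_field_def)

lemma wave_cyc: "wave \<alpha> \<phi> (cyc i x) = wave \<alpha> (\<chi> k. \<phi> $ (k - i + 1)) x"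
  unfolding wave_def cyc_def
  by (rule prod.reindex_bij_witness [of _ "\<lambda>k. k - i + 1" "\<lambda>k. i + k - 1"]) auto

text \<open>
  A relabelled wave is a wave with relabelled phases, so all components inherit the form of the first.
\<close>

lemma v_zero_wave_pair:
  "v_zero \<alpha> vr x $ i = wave_pair (- vr) \<alpha> (\<chi> k. first_phases $ (k - i + 1))
      (\<chi> k. second_phases $ (k - i + 1)) x"
  by (simp only: v_zero_component octuple_first_wave_pair wave_pair_def wave_cyc)

lemma partial_v_zero:
  "partial (i + m - 1) (\<lambda>y. v_zero \<alpha> vr y $ i) x
     = partial m (octuple_first \<alpha> vr symmetric_phases) (cyc i x)"
  by (simp only: v_zero_component partial_cyc)

lemma partial_octuple_first:
  "partial m (octuple_first \<alpha> vr symmetric_phases) x = - vr * \<alpha> *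
     (wave \<alpha> (first_phases + axis m (pi / 2)) x + wave \<alpha> (second_phases + axis m (pi / 2)) x)"
  by (simp add: octuple_first_wave_pair partial_wave_pair) (simp add: wave_pair_def)

text \<open>
  Starting the sum over \<open>j\<close> at \<open>j = i\<close> turns it into the sum for the first component at \<open>cyc i x\<close>, to
  which the polynomial identity applies.
\<close>

lemma advection_v_zero:
  "advection (v_zero \<alpha> vr) x $ i
     = \<alpha> * vr^2 / 32 * cos (2 * \<alpha> * x $ i) * H1_tilde (cyc i (sin2 \<alpha> x))"
proof -
  define y where "y = cyc i x"
  define a b where "a = (\<lambda>k. sin (\<alpha> * y $ k + pi / 4))" and "b = (\<lambda>k. cos (\<alpha> * y $ k + pi / 4))"
  have one: "(a k)^2 + (b k)^2 = 1" for k
    by (simp add: a_def b_def)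
  have s: "sin2 \<alpha> y $ k = (a k)^2 - (b k)^2" for k
    using cos_double [of "\<alpha> * y $ k + pi / 4"]
    by (simp add: sin2_def a_def b_def cos_add algebra_simps)
  have c: "cos (2 * \<alpha> * y $ 1) = 2 * a 1 * b 1"
    using sin_double [of "\<alpha> * y $ 1 + pi / 4"]
    by (simp add: a_def b_def sin_add algebra_simps)
  have "advection (v_zero \<alpha> vr) x $ i
      = (\<Sum>m\<in>UNIV. v_zero \<alpha> vr x $ (i + m - 1)
          * partial (i + m - 1) (\<lambda>y. v_zero \<alpha> vr y $ i) x)"
    by (simp add: advection_def sum_cyclic [of "\<lambda>j. v_zero \<alpha> vr x $ j * partial j (\<lambda>y. v_zero \<alpha> vr y $ i) x"])
  also have "\<dots> = (\<Sum>m\<in>UNIV. octuple_first \<alpha> vr symmetric_phases (cyc m y)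
          * partial m (octuple_first \<alpha> vr symmetric_phases) y)"
    unfolding partial_v_zero by (simp only: v_zero_component cyc_cyc y_def)
  also have "\<dots> = \<alpha> * vr^2 * (a 1 * b 1 / 16 * H1_tilde (sin2 \<alpha> y))"
    unfolding advection_identity [of a b "sin2 \<alpha> y", OF one s, symmetric] sum_distrib_left
    unfolding octuple_first_cyc partial_octuple_first wave_quarter_phases_shifted Let_def a_def b_def
    by (rule sum.cong [OF refl])
      (simp only: power2_eq_square mult_minus_left mult_minus_right minus_minus ac_simps)
  also have "\<dots> = \<alpha> * vr^2 / 32 * cos (2 * \<alpha> * y $ 1) * H1_tilde (sin2 \<alpha> y)"
    by (simp add: c)
  finally show ?thesis
    by (simp add: y_def sin2_cyc) (simp add: cyc_def)
qed

text \<open>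
  Up to a constant factor the two halves of \<open>\<partial>\<^sub>1 v\<^sub>1\<close> are \<open>a\<^sub>1 b\<^sub>2 a\<^sub>3 b\<^sub>4 a\<^sub>5 b\<^sub>6 a\<^sub>7 b\<^sub>8\<close> and its shift by one
  index, with opposite signs, so the sum over all components telescopes around the cycle.
\<close>

lemma divergence_v_zero: "divergence (v_zero \<alpha> vr) x = 0"
proof -
  let ?R = "\<lambda>i. wave \<alpha> (quarter_phases {2, 4, 6, 8}) (cyc i x)"
  have "partial i (\<lambda>y. v_zero \<alpha> vr y $ i) x = vr * \<alpha> * (?R i - ?R (2 + i - 1))" for i
  proof -
    have "partial i (\<lambda>y. v_zero \<alpha> vr y $ i) x
        = partial 1 (octuple_first \<alpha> vr symmetric_phases) (cyc i x)"
      using partial_v_zero [of i 1] by simp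
    also have "\<dots> = vr * \<alpha> * (?R i - wave \<alpha> (quarter_phases {2, 4, 6, 8}) (cyc 2 (cyc i x)))"
      unfolding partial_octuple_first wave_quarter_phases_shifted wave_quarter_phases prod_8
      by (simp add: cyc_def [of 2] numeral_wrap_8 algebra_simps)
    also have "cyc 2 (cyc i x) = cyc (2 + i - 1) x"
      by (simp only: cyc_cyc add.commute)
    finally show ?thesis .
  qed
  then show ?thesis
    by (simp only: divergence_def sum_distrib_left [symmetric] sum_subtractf sum_cyclic [of ?R])
      simp
qed

section \<open>The pressure\<close>

text \<open>
  Written cyclically, each pair of distinct indices of equal parity is counted twice, which halves
  the prefactor and makes the invariance under relabelling visible.
\<close>

lemma p_star_sum:
  "p_star \<alpha> vr \<rho> x = \<rho> * vr^2 / 128 * (\<Sum>k\<in>UNIV. sin2 \<alpha> x $ k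
      * (sin2 \<alpha> x $ (k + 2) + sin2 \<alpha> x $ (k + 4) + sin2 \<alpha> x $ (k + 6)))"
proof -
  have "{(i::nat, j::nat). 1 \<le> i \<and> i < j \<and> j \<le> 8 \<and> even (j - i)}
      = {(1, 3), (1, 5), (1, 7), (2, 4), (2, 6), (2, 8), (3, 5), (3, 7), (4, 6), (4, 8), (5, 7), (6, 8)}"
    (is "?A = ?B")
  proof
    show "?A \<subseteq> ?B"
    proof (rule subsetI)
      fix z assume "z \<in> ?A"
      then obtain i j where z: "z = (i, j)" and *: "1 \<le> i" "i < j" "j \<le> 8" "even (j - i)"
        by auto
      from * have "i \<in> {1, 2, 3, 4, 5, 6, 7}" and "j \<in> {2, 3, 4, 5, 6, 7, 8}"
        by auto
      with * show "z \<in> ?B"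
        unfolding z by (elim insertE) simp_all
    qed
  qed auto
  then show ?thesis
    by (simp add: p_star_def sum_8 numeral_wrap_8 algebra_simps)
qed

lemma p_star_cyc: "p_star \<alpha> vr \<rho> (cyc i x) = p_star \<alpha> vr \<rho> x"
proof -
  define g where "g k = sin2 \<alpha> x $ k
      * (sin2 \<alpha> x $ (k + 2) + sin2 \<alpha> x $ (k + 4) + sin2 \<alpha> x $ (k + 6))" for k
  have "cyc i (sin2 \<alpha> x) $ k * (cyc i (sin2 \<alpha> x) $ (k + 2) + cyc i (sin2 \<alpha> x) $ (k + 4)
      + cyc i (sin2 \<alpha> x) $ (k + 6)) = g (i + k - 1)" for k
    by (simp add: cyc_def g_def add_diff_eq [symmetric] add.assoc) (simp add: algebra_simps)
  then show ?thesis
    using sum_cyclic [of g i] by (simp add: p_star_sum sin2_cyc g_def)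
qed

text \<open>
  By cyclic invariance only the derivative along the first coordinate has to be computed, where three
  of the twelve pairs contribute.
\<close>

lemma p_star_has_partial:
  shows partial_p_star: "partial i (p_star \<alpha> vr \<rho>) x = \<rho> * (\<alpha> * vr^2 / 32 * cos (2 * \<alpha> * x $ i)
      * (sin2 \<alpha> x $ (i + 2) + sin2 \<alpha> x $ (i + 4) + sin2 \<alpha> x $ (i + 6)))"
    and has_partial_p_star: "has_partial i (p_star \<alpha> vr \<rho>) x"
proof -
  have first: "((\<lambda>h. p_star \<alpha> vr \<rho> (y + h *\<^sub>R axis 1 1)) has_real_derivative
      \<rho> * (\<alpha> * vr^2 / 32 * cos (2 * \<alpha> * y $ 1)
        * (sin2 \<alpha> y $ 3 + sin2 \<alpha> y $ 5 + sin2 \<alpha> y $ 7))) (at 0)" for y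
    unfolding p_star_sum sum_8 sin2_def
    by (auto simp: axis_def numeral_wrap_8 intro!: derivative_eq_intros) (simp add: algebra_simps)
  have inv: "p_star \<alpha> vr \<rho> = (\<lambda>y. p_star \<alpha> vr \<rho> (cyc i y))"
    by (simp add: p_star_cyc)
  have "partial i (p_star \<alpha> vr \<rho>) x = partial 1 (p_star \<alpha> vr \<rho>) (cyc i x)"
    using partial_cyc [of i 1 "p_star \<alpha> vr \<rho>" x] inv by simp
  then show "partial i (p_star \<alpha> vr \<rho>) x = \<rho> * (\<alpha> * vr^2 / 32 * cos (2 * \<alpha> * x $ i)
      * (sin2 \<alpha> x $ (i + 2) + sin2 \<alpha> x $ (i + 4) + sin2 \<alpha> x $ (i + 6)))"
    by (simp add: partial_eqI(1) [OF first] sin2_cyc) (simp add: cyc_def add_diff_eq [symmetric])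
  show "has_partial i (p_star \<alpha> vr \<rho>) x"
    using has_partial_cyc [of i 1 "p_star \<alpha> vr \<rho>" x] inv partial_eqI(2) [OF first] by simp
qed

lemma pressure_regular_p_star:
  "pressure_regular (\<lambda>t x. p_star \<alpha> vr \<rho> x * exp (b * t))"
proof -
  have cont: "continuous_on S (\<lambda>z. sin2 \<alpha> (snd z) $ k)" "continuous_on S (\<lambda>z. cos (2 * \<alpha> * snd z $ k))"
    for S :: "(real \<times> (real^8)) set" and k
    unfolding sin2_def vec_lambda_beta by (intro continuous_intros)+
  have p: "partial j (\<lambda>y. p_star \<alpha> vr \<rho> y * exp (b * t)) x = exp (b * t) * partial j (p_star \<alpha> vr \<rho>) x"
    "has_partial j (\<lambda>y. p_star \<alpha> vr \<rho> y * exp (b * t)) x" for j t x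
    using partial_cmult [OF has_partial_p_star [of j \<alpha> vr \<rho> x], of "exp (b * t)"]
    by (simp_all add: mult.commute)
  show ?thesis
    unfolding pressure_regular_def p(1) partial_p_star
    unfolding case_prod_beta p_star_sum
  proof (intro conjI allI impI)
    show "continuous_on ({0..} \<times> UNIV) (\<lambda>z. \<rho> * vr^2 / 128 * (\<Sum>k\<in>UNIV. sin2 \<alpha> (snd z) $ k
        * (sin2 \<alpha> (snd z) $ (k + 2) + sin2 \<alpha> (snd z) $ (k + 4) + sin2 \<alpha> (snd z) $ (k + 6)))
        * exp (b * fst z))"
      by (intro continuous_intros cont)
  qed (use p(2) in \<open>simp add: p_star_sum\<close>, intro continuous_intros cont)
qed

section \<open>The force amplitude and the exact solution\<close>

text \<open>
  The pressure gradient supplies exactly the difference between \<open>H1_m\<close> and \<open>H1_tilde\<close>.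
\<close>

lemma f_zero_eq:
  assumes "\<rho> > 0"
  shows "f_zero \<alpha> vr \<rho> x $ i = \<alpha> * vr^2 / 32 * cos (2 * \<alpha> * x $ i) * H_m i (sin2 \<alpha> x)"
proof -
  have "H_m i (sin2 \<alpha> x) = H1_tilde (cyc i (sin2 \<alpha> x))
      + (sin2 \<alpha> x $ (i + 2) + sin2 \<alpha> x $ (i + 4) + sin2 \<alpha> x $ (i + 6))"
    by (simp add: H_m_def H1_m_def cyc_def add_diff_eq [symmetric])
  then show ?thesis
    using assms by (simp add: f_zero_def partial_p_star advection_v_zero algebra_simps)
qed

theorem proposition8p1:
  fixes \<alpha> vr \<rho> \<kappa> :: real
  assumes "\<alpha> > 0" and "vr > 0" and "\<rho> > 0" and "\<kappa> > 0"
  shows "(\<forall>(x::real^8) i. f_zero \<alpha> vr \<rho> x $ i =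
             \<alpha> * vr^2 / 32 * cos (2 * \<alpha> * x $ i) * H_m i (sin2 \<alpha> x)) \<and>
         navier_stokes_solution \<rho> \<kappa>
           (\<lambda>t x. exp (- 8 * \<alpha>^2 * \<kappa> * t) *\<^sub>R v_zero \<alpha> vr x)
           (\<lambda>t x. p_star \<alpha> vr \<rho> x * exp (- 16 * \<alpha>^2 * \<kappa> * t))
           (\<lambda>t x. exp (- 16 * \<alpha>^2 * \<kappa> * t) *\<^sub>R f_zero \<alpha> vr \<rho> x)"
proof -
  let ?v = "v_zero \<alpha> vr" and ?e = "\<lambda>t. exp (- 8 * \<alpha>^2 * \<kappa> * t)"
  have e2: "exp (- 16 * \<alpha>^2 * \<kappa> * t) = ?e t * ?e t" for t
    by (simp flip: exp_add)
  have has_partial_v: "has_partial j (\<lambda>y. ?v y $ i) x" for i j x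
    unfolding v_zero_wave_pair by (rule has_partial_wave_pair)
  have time: "time_deriv (\<lambda>s. (?e s *\<^sub>R ?v x) $ i) t = - 8 * \<alpha>^2 * \<kappa> * (?e t * ?v x $ i)"
    if "t \<ge> 0" for t x i
    by (rule time_deriv_eqI(1) [OF _ that]) (auto intro!: derivative_eq_intros)
  have lap: "laplacian (\<lambda>y. (?e t *\<^sub>R ?v y) $ i) x = - 8 * \<alpha>^2 * (?e t * ?v x $ i)" for t x i
  proof -
    have "(\<lambda>y. (?e t *\<^sub>R ?v y) $ i) = wave_pair (?e t * - vr) \<alpha>
        (\<chi> k. first_phases $ (k - i + 1)) (\<chi> k. second_phases $ (k - i + 1))"
      by (simp add: fun_eq_iff v_zero_wave_pair wave_pair_def)
    then have "laplacian (\<lambda>y. (?e t *\<^sub>R ?v y) $ i) x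
        = - real CARD(8) * \<alpha>^2 * (?e t *\<^sub>R ?v x) $ i"
      by (metis laplacian_wave_pair)
    then show ?thesis by simp
  qed
  have adv: "advection (\<lambda>x. c *\<^sub>R ?v x) x $ i = c * c * advection ?v x $ i" for c x i
    by (simp add: advection_def partial_cmult(1) [OF has_partial_v] sum_distrib_left ac_simps)
  have div: "divergence (\<lambda>x. c *\<^sub>R ?v x) x = 0" for c x
    using divergence_v_zero [of \<alpha> vr x]
    by (simp add: divergence_def partial_cmult(1) [OF has_partial_v] flip: sum_distrib_left)
  have grad: "partial i (\<lambda>y. p_star \<alpha> vr \<rho> y * c) x = c * partial i (p_star \<alpha> vr \<rho>) x" for i c x
    using partial_cmult(1) [OF has_partial_p_star [of i \<alpha> vr \<rho> x], of c]
    by (simp add: mult.commute)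
  have "navier_stokes_solution \<rho> \<kappa> (\<lambda>t x. ?e t *\<^sub>R ?v x)
      (\<lambda>t x. p_star \<alpha> vr \<rho> x * exp (- 16 * \<alpha>^2 * \<kappa> * t))
      (\<lambda>t x. exp (- 16 * \<alpha>^2 * \<kappa> * t) *\<^sub>R f_zero \<alpha> vr \<rho> x)"
    unfolding navier_stokes_solution_def
  proof (intro conjI allI impI)
    show "velocity_regular (\<lambda>t x. ?e t *\<^sub>R ?v x)"
      using v_zero_wave_pair by (rule velocity_regular_wave_pairs)
    show "pressure_regular (\<lambda>t x. p_star \<alpha> vr \<rho> x * exp (- 16 * \<alpha>^2 * \<kappa> * t))"
      by (rule pressure_regular_p_star)
    show "divergence (\<lambda>x. ?e t *\<^sub>R ?v x) x = 0" for t x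
      by (rule div)
    fix t :: real and x i assume "t \<ge> 0"
    show "time_deriv (\<lambda>s. (?e s *\<^sub>R ?v x) $ i) t + advection (\<lambda>x. ?e t *\<^sub>R ?v x) x $ i
        = \<kappa> * laplacian (\<lambda>y. (?e t *\<^sub>R ?v y) $ i) x
          - 1 / \<rho> * partial i (\<lambda>y. p_star \<alpha> vr \<rho> y * exp (- 16 * \<alpha>^2 * \<kappa> * t)) x
          + (exp (- 16 * \<alpha>^2 * \<kappa> * t) *\<^sub>R f_zero \<alpha> vr \<rho> x) $ i"
      unfolding time [OF \<open>t \<ge> 0\<close>] lap adv grad e2
      by (simp add: f_zero_def algebra_simps)
  qed
  then show ?thesis
    using f_zero_eq [OF \<open>\<rho> > 0\<close>] by blast
qed

end
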